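(* Let $F:\mathbb{R}\times[a,b]\to\mathbb{R}$, $(p,x)\mapsto F(p,x)$, be differentiable, and suppose there is a constant $\gamma>0$ such that $$0>-\frac1\gamma\ \ge\ \frac{\partial F}{\partial p}\ \ge\ -\gamma$$ everywhere. Let $\beta_1,\beta_2,\beta_3\ge0$ be constants with $\beta_1+\beta_2+\beta_3=1$, let $\alpha>0$, and set $$\widehat F_\beta(p_1,p_2,p_3,x)=F(\beta_1p_1+\beta_2p_2+\beta_3p_3,\,x)+\alpha\,(p_1-2p_2+p_3).$$ Then $\widehat F_\beta$ is g-monotone provided that $$\alpha>\max\{\beta_1,\beta_3\}\,\gamma.$$
   Context: $a<b$ are real numbers. The parameter $\alpha$ is a positive constant or a positive function of $x$ (the inequality then being required at every $x$). A function $\widehat F(p_1,p_2,p_3,x)$ (numerical operator) is *g-monotone* if, for each grid point $x=x_j$, $j=2,\dots,J-1$, where $x_j=a+(j-1)h$ and $h=\frac{b-a}{J-1}$, the function $\widehat F(p_1,p_2,p_3,x_j)$ is monotone increasing in $p_1$ and in $p_3$ and monotone decreasing in $p_2$. *)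

theory Defs
  imports "HOL-Analysis.Analysis"
begin

definition grid_step :: "real \<Rightarrow> real \<Rightarrow> nat \<Rightarrow> real" where
  "grid_step a b J = (b - a) / (real J - 1)"

text \<open>Grid points are numbered from 1, so the endpoints are the points number 1 and J.\<close>

definition grid_point :: "real \<Rightarrow> real \<Rightarrow> nat \<Rightarrow> nat \<Rightarrow> real" where
  "grid_point a b J j = a + (real j - 1) * grid_step a b J"

text \<open>Monotonicity is in the usual non-strict sense and is required at interior grid points
  only; there are none when \<open>J \<le> 2\<close>.\<close>

definition g_monotone ::
  "real \<Rightarrow> real \<Rightarrow> nat \<Rightarrow> (real \<Rightarrow> real \<Rightarrow> real \<Rightarrow> real \<Rightarrow> real) \<Rightarrow> bool" where
  "g_monotone a b J G \<longleftrightarrow>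
     (\<forall>j\<in>{2..J - 1}.
        (\<forall>p2 p3. mono (\<lambda>p1. G p1 p2 p3 (grid_point a b J j))) \<and>
        (\<forall>p1 p3. antimono (\<lambda>p2. G p1 p2 p3 (grid_point a b J j))) \<and>
        (\<forall>p1 p2. mono (\<lambda>p3. G p1 p2 p3 (grid_point a b J j))))"

text \<open>The parameter \<open>\<alpha>\<close> is a function of \<open>x\<close>; a constant parameter is the case of a
  constant function. Only the values of \<open>F\<close> and \<open>\<alpha>\<close> at \<open>x\<close> in \<open>{a..b}\<close> are meaningful.\<close>

definition F_hat ::
  "(real \<times> real \<Rightarrow> real) \<Rightarrow> real \<Rightarrow> real \<Rightarrow> real \<Rightarrow> (real \<Rightarrow> real) \<Rightarrow>
   real \<Rightarrow> real \<Rightarrow> real \<Rightarrow> real \<Rightarrow> real" where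
  "F_hat F \<beta>1 \<beta>2 \<beta>3 \<alpha> p1 p2 p3 x =
     F (\<beta>1 * p1 + \<beta>2 * p2 + \<beta>3 * p3, x) + \<alpha> x * (p1 - 2 * p2 + p3)"

end

theory Submission imports Defs begin

text \<open>
  At a fixed grid point \<open>x\<close> the bounds on \<open>\<partial>F/\<partial>p\<close> say, through the mean value theorem, that
  \<open>g = F (\<cdot>, x)\<close> is decreasing, but never faster than with slope \<open>-\<gamma>\<close>:
  for \<open>q \<le> r\<close> one has \<open>- \<gamma> * (r - q) \<le> g r - g q \<le> 0\<close>.

  If \<open>p\<^sub>1\<close> or \<open>p\<^sub>3\<close> grows by \<open>\<delta> \<ge> 0\<close>, the argument of \<open>g\<close> grows by \<open>\<beta>\<^sub>i * \<delta>\<close>, so the \<open>g\<close>-term loses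
  at most \<open>\<gamma> * \<beta>\<^sub>i * \<delta>\<close>, while the numerical moment \<open>\<alpha> * (p\<^sub>1 - 2 * p\<^sub>2 + p\<^sub>3)\<close> gains \<open>\<alpha> * \<delta>\<close>; the
  assumption on \<open>\<alpha>\<close> makes the gain win (\<open>decreasing_slope_bound_moment_mono\<close>).
  In \<open>p\<^sub>2\<close> both terms are decreasing, so there is nothing to balance.
\<close>

lemma differentiable_on_slice:
  fixes F :: "'a::real_normed_vector \<times> 'b::real_normed_vector \<Rightarrow> 'c::real_normed_vector"
  assumes "F differentiable_on (UNIV \<times> S)" "x \<in> S"
  shows "(\<lambda>q. F (q, x)) differentiable (at p)"
proof -
  have outer: "F differentiable (at (p, x) within (\<lambda>q. (q, x)) ` UNIV)"
    using assms
    by (auto simp: differentiable_on_def intro: differentiable_within_subset)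
  have inner: "(\<lambda>q. (q, x)) differentiable (at p)"
    by (rule differentiableI, rule has_derivative_Pair[OF has_derivative_ident has_derivative_const])
  show ?thesis
    using differentiable_chain_within[OF inner outer] by (simp add: o_def)
qed

lemma deriv_bounds_imp_increment_bounds:
  fixes g :: "real \<Rightarrow> real"
  assumes diff: "\<And>p. g differentiable (at p)"
    and upper: "\<And>p. deriv g p \<le> M" and lower: "\<And>p. m \<le> deriv g p"
    and "q \<le> r"
  shows "m * (r - q) \<le> g r - g q" and "g r - g q \<le> M * (r - q)"
proof -
  have D: "(g has_real_derivative deriv g p) (at p)" for p
    using diff[of p] by (simp add: DERIV_deriv_iff_real_differentiable)
  have "\<exists>z. g r - g q = (r - q) * deriv g z"
  proof (cases "q = r")
    case False
    with \<open>q \<le> r\<close> show ?thesis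
      using MVT2[of q r g "deriv g"] D by auto
  qed simp
  then obtain z where z: "g r - g q = (r - q) * deriv g z" ..
  show "m * (r - q) \<le> g r - g q" "g r - g q \<le> M * (r - q)"
    using \<open>q \<le> r\<close> lower[of z] upper[of z]
    by (simp_all add: z mult.commute[of "r - q"] mult_right_mono)
qed

lemma grid_point_in_interval:
  assumes "a \<le> b" "j \<in> {1..J}" "2 \<le> J"
  shows "grid_point a b J j \<in> {a..b}"
proof -
  define t where "t = (real j - 1) / (real J - 1)"
  have "0 \<le> t" "t \<le> 1"
    using assms by (auto simp: t_def)
  then have "0 \<le> t * (b - a)" "t * (b - a) \<le> b - a"
    using assms(1) by (auto intro: mult_left_le_one_le)
  moreover have "grid_point a b J j = a + t * (b - a)"
    by (simp add: grid_point_def grid_step_def t_def)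
  ultimately show ?thesis by auto
qed

text \<open>
  The balance in one outer slot: \<open>p\<close> plays the role of \<open>p\<^sub>1\<close> or \<open>p\<^sub>3\<close> and \<open>\<beta>\<close> that of its weight,
  while \<open>c\<close> and \<open>d\<close> collect what the other two slots contribute to the argument of \<open>g\<close> and to
  the moment.
\<close>

lemma decreasing_slope_bound_moment_mono:
  fixes g :: "real \<Rightarrow> real"
  assumes slope: "\<And>q r. q \<le> r \<Longrightarrow> - \<gamma> * (r - q) \<le> g r - g q"
    and "0 \<le> \<beta>" "\<beta> * \<gamma> \<le> \<alpha>"
  shows "mono (\<lambda>p. g (\<beta> * p + c) + \<alpha> * (p + d))"
proof (rule monoI)
  fix u v :: real
  assume "u \<le> v"
  then have "- \<gamma> * (\<beta> * (v - u)) \<le> g (\<beta> * v + c) - g (\<beta> * u + c)"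
    using slope[of "\<beta> * u + c" "\<beta> * v + c"] \<open>0 \<le> \<beta>\<close>
    by (simp add: mult_left_mono right_diff_distrib)
  moreover have "\<beta> * \<gamma> * (v - u) \<le> \<alpha> * (v - u)"
    using \<open>u \<le> v\<close> \<open>\<beta> * \<gamma> \<le> \<alpha>\<close> by (simp add: mult_right_mono)
  ultimately show "g (\<beta> * u + c) + \<alpha> * (u + d) \<le> g (\<beta> * v + c) + \<alpha> * (v + d)"
    by (simp add: algebra_simps)
qed

theorem theorem4p1:
  fixes a b \<gamma> \<beta>1 \<beta>2 \<beta>3 :: real
    and J :: nat
    and F :: "real \<times> real \<Rightarrow> real"
    and \<alpha> :: "real \<Rightarrow> real"
  assumes "a < b"
    and "F differentiable_on (UNIV \<times> {a..b})"
    and "\<gamma> > 0"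
    and "\<And>p x. x \<in> {a..b} \<Longrightarrow>
           0 > - (1 / \<gamma>) \<and> - (1 / \<gamma>) \<ge> deriv (\<lambda>q. F (q, x)) p \<and> deriv (\<lambda>q. F (q, x)) p \<ge> - \<gamma>"
    and "\<beta>1 \<ge> 0" and "\<beta>2 \<ge> 0" and "\<beta>3 \<ge> 0" and "\<beta>1 + \<beta>2 + \<beta>3 = 1"
    and "\<And>x. x \<in> {a..b} \<Longrightarrow> \<alpha> x > 0"
    and "\<And>x. x \<in> {a..b} \<Longrightarrow> \<alpha> x > max \<beta>1 \<beta>3 * \<gamma>"
  shows "g_monotone a b J (F_hat F \<beta>1 \<beta>2 \<beta>3 \<alpha>)"
proof -
  have "mono (\<lambda>p1. F_hat F \<beta>1 \<beta>2 \<beta>3 \<alpha> p1 p2 p3 x) \<and>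
        antimono (\<lambda>p2. F_hat F \<beta>1 \<beta>2 \<beta>3 \<alpha> p1 p2 p3 x) \<and>
        mono (\<lambda>p3. F_hat F \<beta>1 \<beta>2 \<beta>3 \<alpha> p1 p2 p3 x)"
    if x: "x \<in> {a..b}" for x p1 p2 p3
  proof -
    define g where "g = (\<lambda>q. F (q, x))"
    have diff: "g differentiable (at p)" for p
      unfolding g_def by (rule differentiable_on_slice[OF assms(2) x])
    have upper: "deriv g p \<le> 0" and lower: "- \<gamma> \<le> deriv g p" for p
      using assms(4)[OF x, of p] unfolding g_def by linarith+
    note slope = deriv_bounds_imp_increment_bounds[OF diff upper lower]

    have "\<beta>1 * \<gamma> \<le> max \<beta>1 \<beta>3 * \<gamma>" "\<beta>3 * \<gamma> \<le> max \<beta>1 \<beta>3 * \<gamma>"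
      using \<open>\<gamma> > 0\<close> by (simp_all add: mult_right_mono)
    then have dominates: "\<beta>1 * \<gamma> \<le> \<alpha> x" "\<beta>3 * \<gamma> \<le> \<alpha> x"
      using assms(10)[OF x] by linarith+

    have "mono (\<lambda>p1. g (\<beta>1 * p1 + (\<beta>2 * p2 + \<beta>3 * p3)) + \<alpha> x * (p1 + (p3 - 2 * p2)))"
      using slope(1) \<open>\<beta>1 \<ge> 0\<close> dominates(1) by (rule decreasing_slope_bound_moment_mono)
    then have first: "mono (\<lambda>p1. F_hat F \<beta>1 \<beta>2 \<beta>3 \<alpha> p1 p2 p3 x)"
      by (simp add: F_hat_def g_def algebra_simps)

    have "mono (\<lambda>p3. g (\<beta>3 * p3 + (\<beta>1 * p1 + \<beta>2 * p2)) + \<alpha> x * (p3 + (p1 - 2 * p2)))"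
      using slope(1) \<open>\<beta>3 \<ge> 0\<close> dominates(2) by (rule decreasing_slope_bound_moment_mono)
    then have third: "mono (\<lambda>p3. F_hat F \<beta>1 \<beta>2 \<beta>3 \<alpha> p1 p2 p3 x)"
      by (simp add: F_hat_def g_def algebra_simps)

    have second: "antimono (\<lambda>p2. F_hat F \<beta>1 \<beta>2 \<beta>3 \<alpha> p1 p2 p3 x)"
    proof (rule antimonoI)
      fix u v :: real
      assume "u \<le> v"
      then have "g (\<beta>1 * p1 + \<beta>2 * v + \<beta>3 * p3) \<le> g (\<beta>1 * p1 + \<beta>2 * u + \<beta>3 * p3)"
        using slope(2)[of "\<beta>1 * p1 + \<beta>2 * u + \<beta>3 * p3" "\<beta>1 * p1 + \<beta>2 * v + \<beta>3 * p3"] \<open>\<beta>2 \<ge> 0\<close>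
        by (simp add: mult_left_mono)
      moreover have "\<alpha> x * (p1 - 2 * v + p3) \<le> \<alpha> x * (p1 - 2 * u + p3)"
        using \<open>u \<le> v\<close> assms(9)[OF x] by (intro mult_left_mono) auto
      ultimately show "F_hat F \<beta>1 \<beta>2 \<beta>3 \<alpha> p1 v p3 x \<le> F_hat F \<beta>1 \<beta>2 \<beta>3 \<alpha> p1 u p3 x"
        by (simp add: F_hat_def g_def)
    qed
    show ?thesis using first second third by blast
  qed
  moreover have "grid_point a b J j \<in> {a..b}" if "j \<in> {2..J - 1}" for j
    using that \<open>a < b\<close> by (intro grid_point_in_interval) auto
  ultimately show ?thesis
    unfolding g_monotone_def by blast
qed

end
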